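(* Let $I\subseteq\mathbb{R}$ be an interval and let $f\colon I\to\mathbb{R}$ be a twice continuously differentiable function with a nonvanishing first derivative. Then the quasi-arithmetic mean $\mathscr{A}_f$ is Jensen concave if and only if either $f''$ is identically zero, or $f''$ is nowhere zero and the ratio function $\frac{f'}{f''}$ is a convex and negative function on $I$.
   Context: For an interval $I$ and a continuous, strictly monotone function $f\colon I\to\mathbb{R}$, the quasi-arithmetic mean generated by $f$ is the map $\mathscr{A}_f\colon\bigcup_{n=1}^\infty I^n\to I$ given, for $n\in\mathbb{N}$ and $x=(x_1,\dots,x_n)\in I^n$, by $$\mathscr{A}_f(x):=f^{-1}\left(\frac{f(x_1)+\cdots+f(x_n)}{n}\right).$$ A mean $M\colon\bigcup_{n=1}^\infty I^n\to I$ is called Jensen concave if, for all $n\in\mathbb{N}$, its $n$-variable restriction $M|_{I^n}$ is Jensen concave on $I^n$, i.e. $M\left(\frac{x+y}{2}\right)\ge\frac{M(x)+M(y)}{2}$ for all $x,y\in I^n$. *)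

theory Defs imports "HOL-Analysis.Analysis" begin

text \<open>
  Elements of the disjoint union of the powers \<open>I\<^sup>n\<close>, \<open>n \<ge> 1\<close>, are nonempty lists over \<open>I\<close>.
  The inverse of \<open>f\<close> is taken on \<open>I\<close> only; off \<open>I\<close> the function \<open>f\<close> is irrelevant.
\<close>

definition quasi_arith_mean :: "real set \<Rightarrow> (real \<Rightarrow> real) \<Rightarrow> real list \<Rightarrow> real" where
  "quasi_arith_mean I f xs = inv_into I f (sum_list (map f xs) / real (length xs))"

definition jensen_concave_mean :: "real set \<Rightarrow> (real list \<Rightarrow> real) \<Rightarrow> bool" where
  "jensen_concave_mean I M \<longleftrightarrow>
     (\<forall>n\<ge>1. \<forall>xs ys. length xs = n \<longrightarrow> length ys = n \<longrightarrow> set xs \<subseteq> I \<longrightarrow> set ys \<subseteq> I \<longrightarrow>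
        M (map2 (\<lambda>x y. (x + y) / 2) xs ys) \<ge> (M xs + M ys) / 2)"

end

theory Submission imports Defs begin

text \<open>
  Replacing \<open>f\<close> by \<open>- f\<close> changes neither the mean nor the ratio \<open>f' / f''\<close>, so assume \<open>f' > 0\<close>; write \<open>\<phi>\<close>
  for the inverse of \<open>f\<close>. In the coordinates \<open>u = f x\<close>, \<open>v = f y\<close> the quasi-arithmetic mean becomes the
  ordinary average, and Jensen concavity of the mean becomes Jensen's inequality
  \<open>G (average of (u\<^sub>i, v\<^sub>i)) \<le> average of G (u\<^sub>i, v\<^sub>i)\<close> for the midpoint function
  \<open>G u v = f ((\<phi> u + \<phi> v) / 2)\<close>. Thus the mean is Jensen concave iff \<open>G\<close> is convex on \<open>f ` I \<times> f ` I\<close>, and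
  lists of length two already decide this.

  Put \<open>p = - f'' / f'\<close> and \<open>z = (x + y) / 2\<close>. Differentiating \<open>G\<close> twice along a line gives, up to a
  positive factor, the quadratic form
  \<open>Q x y a b = 2 * p x * a\<^sup>2 + 2 * p y * b\<^sup>2 - p z * (a + b)\<^sup>2\<close>, where \<open>a\<close> and \<open>b\<close> are the velocities of \<open>x\<close> and \<open>y\<close>
  (\<open>second_derivative_along_line\<close>). Hence the mean is Jensen concave iff all these forms are nonnegative
  (\<open>G_convex_of_Q_nonneg\<close>, \<open>concave_mean_of_G_convex\<close>, \<open>Q_nonneg\<close>).

  If \<open>p > 0\<close>, minimising \<open>2 * p x * a\<^sup>2 + 2 * p y * b\<^sup>2\<close> for a fixed sum \<open>a + b\<close> shows that nonnegativity means
  \<open>1 / p z \<ge> (1 / p x + 1 / p y) / 2\<close>, which is midpoint convexity of \<open>f' / f'' = - 1 / p\<close>; by continuity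
  this is convexity (\<open>convex_on_of_midpoint_convex\<close>). In general nonnegativity forces \<open>p \<ge> 0\<close>, and a single
  zero of \<open>p\<close> spreads to all of \<open>I\<close>: if \<open>p x = 0\<close> then \<open>p\<close> vanishes at the midpoint of \<open>x\<close> and every \<open>y\<close>,
  and iterated bisection towards \<open>y\<close> gives \<open>p y = 0\<close>. This is the dichotomy of the theorem
  (\<open>ratio_convex_of_Q_nonneg\<close>, \<open>Q_nonneg_of_ratio_convex\<close>).
\<close>

section \<open>Convexity on the real line\<close>

text \<open>
  The mean value theorem on both sides of \<open>t\<close> turns the slopes of the two partial chords into values
  of \<open>g'\<close>, which is nondecreasing. The derivatives at \<open>0\<close> and \<open>1\<close> are one-sided because the segment may
  end on the boundary of the domain of \<open>G\<close>.
\<close>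

lemma chord_above_of_second_derivative_nonneg:
  fixes g g' g'' :: "real \<Rightarrow> real"
  assumes g: "\<And>t. t \<in> {0..1} \<Longrightarrow> (g has_real_derivative g' t) (at t within {0..1})"
    and g': "\<And>t. t \<in> {0..1} \<Longrightarrow> (g' has_real_derivative g'' t) (at t within {0..1})"
    and nonneg: "\<And>t. t \<in> {0..1} \<Longrightarrow> g'' t \<ge> 0"
    and t: "0 < t" "t < 1"
  shows "g t \<le> (1 - t) * g 0 + t * g 1"
proof -
  have cont: "continuous_on {0..1} g"
    using g by (meson DERIV_continuous continuous_on_eq_continuous_within)
  have inner: "at s within {0..1} = at s" if "0 < s" "s < 1" for s :: real
    using that by (intro at_within_interior) auto
  have dg: "(g has_real_derivative g' s) (at s)" if "0 < s" "s < 1" for s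
    using g[of s] inner that by auto
  have dg': "(g' has_real_derivative g'' s) (at s)" if "0 < s" "s < 1" for s
    using g'[of s] inner that by auto
  have diff: "g differentiable at s" if "0 < s" "s < 1" for s
    using dg[OF that] real_differentiable_def by blast
  have "\<exists>l c. 0 < c \<and> c < t \<and> (g has_real_derivative l) (at c) \<and> g t - g 0 = (t - 0) * l"
    using t by (intro MVT continuous_on_subset[OF cont])
      (auto intro: diff)
  then obtain c where c: "0 < c" "c < t" "g t - g 0 = t * g' c"
    using dg t by (metis DERIV_unique diff_zero less_trans)
  have "\<exists>l d. t < d \<and> d < 1 \<and> (g has_real_derivative l) (at d) \<and> g 1 - g t = (1 - t) * l"
    using t by (intro MVT continuous_on_subset[OF cont])
      (auto intro: diff)
  then obtain d where d: "t < d" "d < 1" "g 1 - g t = (1 - t) * g' d"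
    using dg t by (metis DERIV_unique less_trans)
  have "g' c \<le> g' d"
  proof (rule DERIV_nonneg_imp_nondecreasing[of c d g'])
    show "c \<le> d" using c d by simp
    fix s assume "c \<le> s" "s \<le> d"
    then have "0 < s" "s < 1" using c d by auto
    then show "\<exists>y. (g' has_real_derivative y) (at s) \<and> 0 \<le> y"
      using dg'[of s] nonneg[of s] by auto
  qed
  then have "t * (1 - t) * g' c \<le> t * (1 - t) * g' d"
    using t by (intro mult_left_mono) auto
  then have "(1 - t) * (g t - g 0) \<le> t * (g 1 - g t)"
    unfolding c(3) d(3) by (simp add: mult_ac)
  then show ?thesis by (simp add: algebra_simps)
qed

text \<open>
  The function \<open>g t + g (- t)\<close> has derivative \<open>0\<close> and second derivative \<open>2 * D\<close> at \<open>0\<close>. If \<open>D < 0\<close>, it would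
  decrease strictly to the right of \<open>0\<close>.
\<close>

lemma second_derivative_nonneg_of_midpoint_inequality:
  fixes g g' :: "real \<Rightarrow> real"
  assumes "\<epsilon> > 0"
    and g: "\<And>t. \<bar>t\<bar> < \<epsilon> \<Longrightarrow> (g has_real_derivative g' t) (at t)"
    and g': "(g' has_real_derivative D) (at 0)"
    and mid: "\<And>t. 0 < t \<Longrightarrow> t < \<epsilon> \<Longrightarrow> 2 * g 0 \<le> g t + g (- t)"
  shows "D \<ge> 0"
proof (rule ccontr)
  assume "\<not> D \<ge> 0"
  have "((\<lambda>t. g' t - g' (- t)) has_real_derivative D - D * (- 1)) (at 0)"
    by (rule DERIV_diff[OF g' DERIV_chain2]) (use g' in \<open>auto intro!: derivative_eq_intros\<close>)
  then obtain \<delta> where \<delta>: "\<delta> > 0" "\<And>t. 0 < t \<Longrightarrow> t < \<delta> \<Longrightarrow> g' t - g' (- t) < 0"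
    using DERIV_neg_dec_right[of "\<lambda>t. g' t - g' (- t)" "D - D * (- 1)" 0] \<open>\<not> D \<ge> 0\<close> by auto
  define t where "t = min \<delta> \<epsilon> / 2"
  have t: "0 < t" "t < \<delta>" "t < \<epsilon>" using \<delta>(1) \<open>\<epsilon> > 0\<close> by (auto simp: t_def)
  have der: "((\<lambda>s. g s + g (- s)) has_real_derivative g' s - g' (- s)) (at s)" if "\<bar>s\<bar> < \<epsilon>" for s
  proof -
    have "((\<lambda>s. g s + g (- s)) has_real_derivative g' s + g' (- s) * (- 1)) (at s)"
      by (rule DERIV_add[OF g DERIV_chain2[where f = g]])
        (use that in \<open>auto intro!: derivative_eq_intros g\<close>)
    then show ?thesis by simp
  qed
  have "g t + g (- t) < g 0 + g (- 0)"
  proof (rule DERIV_neg_imp_decreasing_open[of 0 t "\<lambda>s. g s + g (- s)"])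
    show "continuous_on {0..t} (\<lambda>s. g s + g (- s))"
      by (rule DERIV_atLeastAtMost_imp_continuous_on) (use der t in \<open>metis abs_of_nonneg le_less_trans\<close>)
    show "\<exists>y. ((\<lambda>s. g s + g (- s)) has_real_derivative y) (at s) \<and> y < 0" if "0 < s" "s < t" for s
      using der[of s] \<delta>(2)[of s] that t by auto
  qed (use t in auto)
  with mid[OF t(1,3)] show False by simp
qed

text \<open>
  Subtract the chord over \<open>{x..y}\<close>. If the difference \<open>h\<close> were positive somewhere, consider the
  leftmost point \<open>c\<close> at which it attains its maximum. Since \<open>h\<close> vanishes at both ends, \<open>c\<close> is interior and
  hence the midpoint of a subinterval; at the left end of that subinterval \<open>h\<close> is smaller than at \<open>c\<close>,
  at the right end it is not larger, which contradicts midpoint convexity.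
\<close>

lemma convex_on_of_midpoint_convex:
  fixes r :: "real \<Rightarrow> real"
  assumes "convex I" and cont: "continuous_on I r"
    and mid: "\<And>x y. x \<in> I \<Longrightarrow> y \<in> I \<Longrightarrow> r ((x + y) / 2) \<le> (r x + r y) / 2"
  shows "convex_on I r"
proof (rule convex_on_linorderI)
  fix t x y :: real
  assume t: "0 < t" "t < 1" and xy: "x \<in> I" "y \<in> I" "x < y"
  have sub: "{x..y} \<subseteq> I"
    using \<open>convex I\<close> xy by (metis closed_segment_eq_real_ivl convex_contains_segment less_imp_le)
  define m where "m = (r y - r x) / (y - x)"
  define h where "h = (\<lambda>s. r s - (r x + m * (s - x)))"
  have hx: "h x = 0" and hy: "h y = 0" using xy by (auto simp: h_def m_def)
  have hcont: "continuous_on {x..y} h"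
    unfolding h_def by (intro continuous_intros continuous_on_subset[OF cont sub])
  have hmid: "h s \<le> (h (s - d) + h (s + d)) / 2" if "s - d \<in> {x..y}" "s + d \<in> {x..y}" for s d
    proof -
    have "s - d \<in> I" "s + d \<in> I" using that sub by blast+
    from mid[OF this] show ?thesis by (simp add: h_def algebra_simps)
  qed
  have "h s \<le> 0" if "s \<in> {x..y}" for s
  proof (rule ccontr)
    assume "\<not> h s \<le> 0"
    obtain M where M: "M \<in> {x..y}" "\<And>z. z \<in> {x..y} \<Longrightarrow> h z \<le> h M"
      using continuous_attains_sup[OF _ _ hcont] xy by fastforce
    have "h M > 0" using M(2)[OF that] \<open>\<not> h s \<le> 0\<close> by simp
    let ?C = "{x..y} \<inter> h -` {h M}"
    have "compact ?C"
      using continuous_closed_preimage[OF hcont closed_atLeastAtMost closed_singleton]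
      by (simp add: compact_eq_bounded_closed bounded_Int)
    then obtain c where c: "c \<in> ?C" "\<And>z. z \<in> ?C \<Longrightarrow> c \<le> z"
      using M(1) compact_attains_inf[of ?C] by blast
    have "x < c" "c < y"
      using c(1) hx hy \<open>h M > 0\<close> by (auto simp: less_le)
    define d where "d = min (c - x) (y - c)"
    have d: "d > 0" "c - d \<in> {x..y}" "c + d \<in> {x..y}"
      using \<open>x < c\<close> \<open>c < y\<close> by (auto simp: d_def)
    have "h (c - d) < h M"
      using M(2)[OF d(2)] c(2)[of "c - d"] d by (cases "h (c - d) = h M") auto
    then show False
      using hmid[OF d(2,3)] M(2)[OF d(3)] c(1) by auto
  qed
  moreover have "(1 - t) * x + t * y \<in> {x..y}"
    using convexD_alt[OF convex_real_interval(5)[of x y], of x y t] t xy by auto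
  ultimately have "h ((1 - t) * x + t * y) \<le> 0" .
  moreover have "m * (t * (y - x)) = t * (r y - r x)" using xy by (simp add: m_def)
  ultimately show "r ((1 - t) *\<^sub>R x + t *\<^sub>R y) \<le> (1 - t) * r x + t * r y"
    by (simp add: h_def algebra_simps)
qed (use assms in auto)

section \<open>The midpoint function in the coordinates of the generator\<close>

text \<open>
  The sign of \<open>f'\<close> is fixed so that \<open>f\<close> and \<open>\<phi>\<close> preserve order and \<open>G\<close> comes out convex.
\<close>

locale increasing_generator =
  fixes I :: "real set" and f f' f'' :: "real \<Rightarrow> real"
  assumes interval: "is_interval I"
    and nondegenerate: "\<exists>a\<in>I. \<exists>b\<in>I. a < b"
    and f_deriv: "\<And>x. x \<in> I \<Longrightarrow> (f has_real_derivative f' x) (at x within I)"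
    and f'_deriv: "\<And>x. x \<in> I \<Longrightarrow> (f' has_real_derivative f'' x) (at x within I)"
    and f''_cont: "continuous_on I f''"
    and f'_pos: "\<And>x. x \<in> I \<Longrightarrow> f' x > 0"
begin

definition \<phi> where "\<phi> = inv_into I f"
definition G where "G u v = f ((\<phi> u + \<phi> v) / 2)"

text \<open>
  In economics \<open>p\<close> is the Arrow--Pratt index of absolute risk aversion of the utility function \<open>f\<close>.
  Unlike the ratio \<open>f' / f''\<close>, of which it is minus the reciprocal, it is continuous even where \<open>f''\<close>
  vanishes.
\<close>
definition p where "p x = - f'' x / f' x"

text \<open>
  Up to the factor \<open>f' ((x + y) / 2) / 4\<close>, this is the Hessian of \<open>G\<close> at \<open>(f x, f y)\<close> in the direction
  \<open>(a * f' x, b * f' y)\<close>.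
\<close>
definition Q where "Q x y a b = 2 * p x * a\<^sup>2 + 2 * p y * b\<^sup>2 - p ((x + y) / 2) * (a + b)\<^sup>2"

lemma convex_I: "convex I"
  using interval by (simp add: is_interval_convex)

lemma midpoint_in_I: "x \<in> I \<Longrightarrow> y \<in> I \<Longrightarrow> (x + y) / 2 \<in> I"
  using convexD[OF convex_I, of x y "1/2" "1/2"] by (simp add: add_divide_distrib)

lemma f_cont: "continuous_on I f"
  using f_deriv by (meson DERIV_continuous continuous_on_eq_continuous_within)

lemma f'_cont: "continuous_on I f'"
  using f'_deriv by (meson DERIV_continuous continuous_on_eq_continuous_within)

lemma f_less: "f x < f y" if "x \<in> I" "y \<in> I" "x < y"
proof (rule DERIV_pos_imp_increasing_open[OF \<open>x < y\<close>])
  have sub: "{x..y} \<subseteq> I"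
    using convex_I that by (metis closed_segment_eq_real_ivl convex_contains_segment less_imp_le)
  show "continuous_on {x..y} f" using f_cont sub continuous_on_subset by blast
  fix s assume s: "x < s" "s < y"
  have "(f has_real_derivative f' s) (at s within {x..y})"
    using s sub by (intro DERIV_subset[OF f_deriv]) auto
  moreover have "s \<in> I" using s sub by auto
  moreover have "at s within {x..y} = at s" using s by (intro at_within_interior) auto
  ultimately show "\<exists>l. (f has_real_derivative l) (at s) \<and> 0 < l"
    using f'_pos[of s] by auto
qed

lemma f_le_iff: "x \<in> I \<Longrightarrow> y \<in> I \<Longrightarrow> f x \<le> f y \<longleftrightarrow> x \<le> y"
  using f_less by (metis linorder_not_le order_le_less)

lemma f_inj: "inj_on f I"
  by (rule inj_onI) (metis f_le_iff order_antisym order_refl)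

lemma \<phi>_f: "x \<in> I \<Longrightarrow> \<phi> (f x) = x"
  by (simp add: \<phi>_def f_inj)

lemma \<phi>_in: "u \<in> f ` I \<Longrightarrow> \<phi> u \<in> I"
  by (simp add: \<phi>_def inv_into_into)

lemma f_\<phi>: "u \<in> f ` I \<Longrightarrow> f (\<phi> u) = u"
  by (simp add: \<phi>_def f_inv_into_f)

lemma convex_image: "convex (f ` I)"
  using connected_continuous_image[OF f_cont] convex_I
  by (simp add: convex_connected flip: is_interval_convex_1 is_interval_connected_1)

lemma \<phi>_cont: "continuous_on (f ` I) \<phi>"
proof -
  have "path_connected I" using convex_I by (rule convex_imp_path_connected)
  then obtain g where g: "homeomorphism I (f ` I) f g"
    using homeomorphism_into_1d[OF _ f_cont refl f_inj] by blast
  have "continuous_on (f ` I) g" using g by (rule homeomorphism_cont2)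
  moreover have "g u = \<phi> u" if "u \<in> f ` I" for u
    using that homeomorphism_apply1[OF g] \<phi>_f by auto
  ultimately show ?thesis by (simp cong: continuous_on_cong)
qed

text \<open>
  The end points of \<open>f ` I\<close> are included. Continuity of \<open>\<phi>\<close> allows the substitution \<open>x = \<phi> w\<close> in the
  difference quotient of \<open>f\<close>.
\<close>

lemma \<phi>_deriv:
  assumes u: "u \<in> f ` I"
  shows "(\<phi> has_real_derivative inverse (f' (\<phi> u))) (at u within f ` I)"
proof -
  have "(\<phi> \<longlongrightarrow> \<phi> u) (at u within f ` I)"
    using \<phi>_cont u unfolding continuous_on_def by blast
  moreover have "eventually (\<lambda>w. \<phi> w \<in> I \<and> \<phi> w \<noteq> \<phi> u) (at u within f ` I)"
    unfolding eventually_at_filter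
    by (rule always_eventually) (metis \<phi>_in f_\<phi> u)
  ultimately have "filterlim \<phi> (at (\<phi> u) within I) (at u within f ` I)"
    by (auto simp: filterlim_at elim: eventually_mono)
  moreover have "((\<lambda>x. (f x - f (\<phi> u)) / (x - \<phi> u)) \<longlongrightarrow> f' (\<phi> u)) (at (\<phi> u) within I)"
    using f_deriv[OF \<phi>_in[OF u]] by (simp add: has_field_derivative_iff)
  ultimately have "((\<lambda>w. (f (\<phi> w) - f (\<phi> u)) / (\<phi> w - \<phi> u)) \<longlongrightarrow> f' (\<phi> u)) (at u within f ` I)"
    by (rule filterlim_compose[rotated])
  then have "((\<lambda>w. inverse ((f (\<phi> w) - f (\<phi> u)) / (\<phi> w - \<phi> u))) \<longlongrightarrow> inverse (f' (\<phi> u))) (at u within f ` I)"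
    using f'_pos[OF \<phi>_in[OF u]] by (intro tendsto_inverse) auto
  then have "((\<lambda>w. (\<phi> w - \<phi> u) / (w - u)) \<longlongrightarrow> inverse (f' (\<phi> u))) (at u within f ` I)"
    by (rule Lim_transform_eventually)
      (auto simp: eventually_at_filter f_\<phi> u intro!: always_eventually)
  then show ?thesis by (simp add: has_field_derivative_iff)
qed

lemma p_cont: "continuous_on I p"
  unfolding p_def using f'_pos by (intro continuous_intros f''_cont f'_cont) fastforce

lemma deriv_chain_I:
  assumes "(g has_real_derivative D) (at (X t) within I)" "(X has_real_derivative E) (at t within S)" "X ` S \<subseteq> I"
  shows "((\<lambda>s. g (X s)) has_real_derivative D * E) (at t within S)"
  using DERIV_image_chain[OF DERIV_subset[OF assms(1,3)] assms(2)] by (simp add: o_def)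

text \<open>
  The curves \<open>X\<close> and \<open>Y\<close> trace the straight line in the original coordinates, with velocities \<open>A\<close>
  and \<open>B\<close>. The form \<open>Q\<close> arises from \<open>X'' = A' = p X * A\<^sup>2\<close> and \<open>Y'' = B' = p Y * B\<^sup>2\<close>. The parameter set
  \<open>S\<close> is a closed segment in the proof of sufficiency and an open interval in that of necessity.
\<close>

lemma second_derivative_along_line:
  assumes S: "\<And>t. t \<in> S \<Longrightarrow> u + t * du \<in> f ` I" "\<And>t. t \<in> S \<Longrightarrow> v + t * dv \<in> f ` I"
    and "X = (\<lambda>t. \<phi> (u + t * du))" and "Y = (\<lambda>t. \<phi> (v + t * dv))"
    and "A = (\<lambda>t. du / f' (X t))" and "B = (\<lambda>t. dv / f' (Y t))"
    and "t \<in> S"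
  shows "((\<lambda>t. G (u + t * du) (v + t * dv)) has_real_derivative
           f' ((X t + Y t) / 2) * ((A t + B t) / 2)) (at t within S)" (is ?first)
    and "((\<lambda>t. f' ((X t + Y t) / 2) * ((A t + B t) / 2)) has_real_derivative
           f' ((X t + Y t) / 2) / 4 * Q (X t) (Y t) (A t) (B t)) (at t within S)" (is ?second)
proof -
  have curve: "((\<lambda>t. \<phi> (w + t * dw)) has_real_derivative dw / f' (\<phi> (w + t * dw))) (at t within S)"
    if "\<And>t. t \<in> S \<Longrightarrow> w + t * dw \<in> f ` I" for w dw
  proof -
    have "((\<lambda>t. w + t * dw) has_real_derivative dw) (at t within S)"
      by (auto intro!: derivative_eq_intros)
    moreover have "(\<lambda>t. w + t * dw) ` S \<subseteq> f ` I" using that by auto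
    ultimately have "(\<phi> \<circ> (\<lambda>t. w + t * dw) has_real_derivative inverse (f' (\<phi> (w + t * dw))) * dw) (at t within S)"
      by (intro DERIV_image_chain DERIV_subset[OF \<phi>_deriv]) (use that \<open>t \<in> S\<close> in auto)
    then show ?thesis by (simp add: o_def field_simps)
  qed
  have X: "(X has_real_derivative A t) (at t within S)" and Y: "(Y has_real_derivative B t) (at t within S)"
    unfolding assms(3-6) using curve S by blast+
  have XI: "X s \<in> I" and YI: "Y s \<in> I" if "s \<in> S" for s
    using that S \<phi>_in by (auto simp: assms(3,4))
  \<comment> \<open>the velocity \<open>c / f' (Z t)\<close> of a curve \<open>Z\<close> with \<open>f (Z t)\<close> of constant speed \<open>c\<close>\<close>
  have speed: "((\<lambda>s. c / f' (Z s)) has_real_derivative p (Z t) * (c / f' (Z t))\<^sup>2) (at t within S)"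
    if Z: "(Z has_real_derivative c / f' (Z t)) (at t within S)" "Z ` S \<subseteq> I" for Z c
  proof -
    have pos: "f' (Z t) > 0" using that(2) \<open>t \<in> S\<close> f'_pos by auto
    have "((\<lambda>s. f' (Z s)) has_real_derivative f'' (Z t) * (c / f' (Z t))) (at t within S)"
      using that \<open>t \<in> S\<close> by (intro deriv_chain_I f'_deriv) auto
    then have "((\<lambda>s. c / f' (Z s)) has_real_derivative
        (0 * f' (Z t) - c * (f'' (Z t) * (c / f' (Z t)))) / (f' (Z t) * f' (Z t))) (at t within S)"
      using pos by (intro DERIV_divide DERIV_const) auto
    then show ?thesis
      by (rule DERIV_cong) (use pos in \<open>simp add: p_def field_simps power2_eq_square\<close>)
  qed
  have A: "(A has_real_derivative p (X t) * (A t)\<^sup>2) (at t within S)"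
    using speed[of X du] X XI by (auto simp: assms(5))
  have B: "(B has_real_derivative p (Y t) * (B t)\<^sup>2) (at t within S)"
    using speed[of Y dv] Y YI by (auto simp: assms(6))
  have Z: "((\<lambda>s. (X s + Y s) / 2) has_real_derivative (A t + B t) / 2) (at t within S)"
    by (auto intro!: derivative_eq_intros X Y)
  have ZI: "(\<lambda>s. (X s + Y s) / 2) ` S \<subseteq> I" using XI YI midpoint_in_I by auto
  then have zI: "(X t + Y t) / 2 \<in> I" using \<open>t \<in> S\<close> by auto
  show ?first
    using deriv_chain_I[OF f_deriv[OF zI] Z ZI] by (simp add: G_def assms(3,4))
  have AB: "((\<lambda>s. (A s + B s) / 2) has_real_derivative (p (X t) * (A t)\<^sup>2 + p (Y t) * (B t)\<^sup>2) / 2) (at t within S)"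
    by (auto intro!: derivative_eq_intros A B)
  show ?second
    by (rule DERIV_cong[OF DERIV_mult[OF deriv_chain_I[OF f'_deriv[OF zI] Z ZI] AB]])
      (use f'_pos[OF zI] in \<open>simp add: Q_def p_def[of "(X t + Y t) / 2"] field_simps power2_eq_square\<close>)
qed

section \<open>Concavity of the mean and convexity of the midpoint function\<close>

lemma G_convex_of_Q_nonneg:
  assumes Q: "\<And>x y a b. x \<in> I \<Longrightarrow> y \<in> I \<Longrightarrow> Q x y a b \<ge> 0"
  shows "convex_on (f ` I \<times> f ` I) (\<lambda>(u, v). G u v)"
proof (rule convex_onI)
  show "convex (f ` I \<times> f ` I)" by (intro convex_Times convex_image)
  fix t :: real and P R :: "real \<times> real"
  assume t: "0 < t" "t < 1" and PR: "P \<in> f ` I \<times> f ` I" "R \<in> f ` I \<times> f ` I"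
  obtain u v where P: "P = (u, v)" "u \<in> f ` I" "v \<in> f ` I" using PR by auto
  obtain u' v' where R: "R = (u', v')" "u' \<in> f ` I" "v' \<in> f ` I" using PR by auto
  define X where "X = (\<lambda>t. \<phi> (u + t * (u' - u)))"
  define Y where "Y = (\<lambda>t. \<phi> (v + t * (v' - v)))"
  define A where "A = (\<lambda>t. (u' - u) / f' (X t))"
  define B where "B = (\<lambda>t. (v' - v) / f' (Y t))"
  have segment: "w + s * (w' - w) \<in> f ` I" if "w \<in> f ` I" "w' \<in> f ` I" "s \<in> {0..1}" for w w' s
    using convexD_alt[OF convex_image that(1,2), of s] that(3) by (simp add: algebra_simps)
  note derivs = second_derivative_along_line[of "{0..1}" u "u' - u" v "v' - v", OF segment segment X_def Y_def A_def B_def,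
    OF P(2) R(2) _ P(3) R(3)]
  have "G (u + t * (u' - u)) (v + t * (v' - v))
      \<le> (1 - t) * G (u + 0 * (u' - u)) (v + 0 * (v' - v)) + t * G (u + 1 * (u' - u)) (v + 1 * (v' - v))"
  proof (rule chord_above_of_second_derivative_nonneg[OF derivs _ t])
    fix s :: real assume s: "s \<in> {0..1}"
    have XY: "X s \<in> I" "Y s \<in> I"
      using s P R by (auto simp: X_def Y_def intro!: \<phi>_in segment)
    then show "f' ((X s + Y s) / 2) / 4 * Q (X s) (Y s) (A s) (B s) \<ge> 0"
      using Q f'_pos[OF midpoint_in_I[OF XY]] by (simp add: less_imp_le)
  qed auto
  then show "(case (1 - t) *\<^sub>R P + t *\<^sub>R R of (u, v) \<Rightarrow> G u v)
      \<le> (1 - t) * (case P of (u, v) \<Rightarrow> G u v) + t * (case R of (u, v) \<Rightarrow> G u v)"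
    by (simp add: P R algebra_simps)
qed

text \<open>
  Hence the mean really is a preimage under \<open>f\<close>, and \<open>f\<close> cancels \<open>\<phi>\<close> at the average.
\<close>

lemma average_in_image:
  assumes "set xs \<subseteq> I" "xs \<noteq> []"
  shows "sum_list (map f xs) / real (length xs) \<in> f ` I"
proof -
  have "(\<Sum>i<length xs. (1 / real (length xs)) *\<^sub>R f (xs ! i)) \<in> f ` I"
    using assms by (intro convex_sum convex_image) (auto simp: subset_iff)
  then show ?thesis
    by (simp add: sum_list_sum_nth atLeast0LessThan sum_divide_distrib)
qed

text \<open>
  This is Jensen's inequality for \<open>G\<close> at the points \<open>(f x\<^sub>i, f y\<^sub>i)\<close> with equal weights, since
  \<open>G (f x\<^sub>i) (f y\<^sub>i) = f ((x\<^sub>i + y\<^sub>i) / 2)\<close>.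
\<close>

lemma concave_mean_of_G_convex:
  assumes conv: "convex_on (f ` I \<times> f ` I) (\<lambda>(u, v). G u v)"
  shows "jensen_concave_mean I (quasi_arith_mean I f)"
  unfolding jensen_concave_mean_def
proof (intro allI impI)
  fix n :: nat and xs ys :: "real list"
  assume n: "n \<ge> 1" and len: "length xs = n" "length ys = n" and sub: "set xs \<subseteq> I" "set ys \<subseteq> I"
  define zs where "zs = map2 (\<lambda>x y. (x + y) / 2) xs ys"
  define U where "U = sum_list (map f xs) / real n"
  define V where "V = sum_list (map f ys) / real n"
  define W where "W = sum_list (map f zs) / real n"
  have lenz: "length zs = n" by (simp add: zs_def len)
  have xI: "xs ! i \<in> I" and yI: "ys ! i \<in> I" and z: "zs ! i = (xs ! i + ys ! i) / 2" if "i < n" for i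
    using that sub len by (auto simp: zs_def)
  have subz: "set zs \<subseteq> I"
    using xI yI z midpoint_in_I unfolding subset_iff in_set_conv_nth lenz by metis
  have UVW: "U \<in> f ` I" "V \<in> f ` I" "W \<in> f ` I"
    using average_in_image[OF sub(1)] average_in_image[OF sub(2)] average_in_image[OF subz] n len lenz
    by (force simp: U_def V_def W_def)+
  have avg: "sum_list (map f ws) / real n = (\<Sum>i<n. (1 / real n) * f (ws ! i))" if "length ws = n" for ws
    using that by (simp add: sum_list_sum_nth atLeast0LessThan sum_divide_distrib)
  have "(\<lambda>(u, v). G u v) (\<Sum>i<n. (1 / real n) *\<^sub>R (f (xs ! i), f (ys ! i)))
      \<le> (\<Sum>i<n. (1 / real n) * (\<lambda>(u, v). G u v) (f (xs ! i), f (ys ! i)))"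
    using n xI yI by (intro convex_on_sum[OF _ _ conv]) (auto simp: lessThan_empty_iff)
  moreover have "(\<Sum>i<n. (1 / real n) *\<^sub>R (f (xs ! i), f (ys ! i))) = (U, V)"
    unfolding U_def V_def avg[OF len(1)] avg[OF len(2)]
    by (simp add: sum_prod scaleR_prod_def)
  moreover have "(\<Sum>i<n. (1 / real n) * G (f (xs ! i)) (f (ys ! i))) = W"
    unfolding W_def avg[OF lenz] by (intro sum.cong) (auto simp: G_def \<phi>_f xI yI z)
  ultimately have "G U V \<le> W" by simp
  then have "(\<phi> U + \<phi> V) / 2 \<le> \<phi> W"
    using f_le_iff[of "(\<phi> U + \<phi> V) / 2" "\<phi> W"] UVW by (simp add: G_def f_\<phi> \<phi>_in midpoint_in_I)
  then show "(quasi_arith_mean I f xs + quasi_arith_mean I f ys) / 2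
      \<le> quasi_arith_mean I f (map2 (\<lambda>x y. (x + y) / 2) xs ys)"
    by (simp add: quasi_arith_mean_def U_def V_def W_def \<phi>_def len lenz flip: zs_def)
qed

text \<open>
  Two-element lists suffice: choose their entries so that \<open>f\<close> maps them to \<open>u \<plusminus> du\<close> and \<open>v \<plusminus> dv\<close>; the means
  are then \<open>\<phi> u\<close> and \<open>\<phi> v\<close>.
\<close>

lemma G_midpoint_of_concave_mean:
  assumes conc: "jensen_concave_mean I (quasi_arith_mean I f)"
    and "u + du \<in> f ` I" "u - du \<in> f ` I" "v + dv \<in> f ` I" "v - dv \<in> f ` I"
  shows "2 * G u v \<le> G (u + du) (v + dv) + G (u - du) (v - dv)"
proof -
  let ?xs = "[\<phi> (u + du), \<phi> (u - du)]" and ?ys = "[\<phi> (v + dv), \<phi> (v - dv)]"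
  let ?zs = "map2 (\<lambda>x y. (x + y) / 2) ?xs ?ys"
  define W where "W = (G (u + du) (v + dv) + G (u - du) (v - dv)) / 2"
  have mem: "\<phi> (u + du) \<in> I" "\<phi> (u - du) \<in> I" "\<phi> (v + dv) \<in> I" "\<phi> (v - dv) \<in> I"
    using assms by (auto intro: \<phi>_in)
  have mid: "(w + w') / 2 \<in> f ` I" if "w \<in> f ` I" "w' \<in> f ` I" for w w'
    using convexD[OF convex_image that, of "1/2" "1/2"] by (simp add: add_divide_distrib)
  have uv: "u \<in> f ` I" "v \<in> f ` I"
    using mid[OF assms(2,3)] mid[OF assms(4,5)] by auto
  have W: "W \<in> f ` I"
    unfolding W_def G_def by (intro mid imageI midpoint_in_I mem)
  have "(quasi_arith_mean I f ?xs + quasi_arith_mean I f ?ys) / 2 \<le> quasi_arith_mean I f ?zs"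
    using conc mem unfolding jensen_concave_mean_def
    by (elim allE[of _ 2] allE[of _ ?xs] allE[of _ ?ys] impE) auto
  then have "(\<phi> u + \<phi> v) / 2 \<le> \<phi> W"
    using assms by (simp add: quasi_arith_mean_def f_\<phi> W_def G_def flip: \<phi>_def)
  then have "G u v \<le> f (\<phi> W)"
    unfolding G_def using uv W by (subst f_le_iff) (auto intro: midpoint_in_I \<phi>_in)
  then show ?thesis using W by (simp add: f_\<phi> W_def)
qed

text \<open>
  For interior points the line through \<open>(f x, f y)\<close> with direction \<open>(a * f' x, b * f' y)\<close> stays in the
  domain of \<open>G\<close> on both sides, so that the symmetric midpoint inequality yields the sign of the
  second derivative. This direction makes the velocities at time \<open>0\<close> equal to \<open>a\<close> and \<open>b\<close>.
\<close>

lemma Q_nonneg_interior: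
  assumes conc: "jensen_concave_mean I (quasi_arith_mean I f)"
    and x: "x \<in> interior I" and y: "y \<in> interior I"
  shows "Q x y a b \<ge> 0"
proof -
  have near: "\<exists>e>0. \<forall>t. \<bar>t\<bar> < e \<longrightarrow> f c + t * k \<in> f ` I" if c: "c \<in> interior I" for c k
  proof -
    obtain d where d: "d > 0" "cball c d \<subseteq> I"
      using c by (auto simp: mem_interior_cball)
    then have cI: "c \<in> I" "c - d \<in> I" "c + d \<in> I" by (auto simp: subset_iff dist_real_def)
    then have "f (c - d) < f c" "f c < f (c + d)" using f_less d by auto
    moreover have "((\<lambda>t. f c + t * k) \<longlongrightarrow> f c + 0 * k) (at 0)" by (intro tendsto_intros)
    ultimately have "eventually (\<lambda>t. f (c - d) < f c + t * k \<and> f c + t * k < f (c + d)) (at 0)"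
      by (intro eventually_conj order_tendstoD) auto
    then obtain e where e: "e > 0" "\<And>t. t \<noteq> 0 \<Longrightarrow> \<bar>t\<bar> < e \<Longrightarrow> f (c - d) < f c + t * k \<and> f c + t * k < f (c + d)"
      by (auto simp: eventually_at dist_real_def)
    have "f c + t * k \<in> f ` I" if "\<bar>t\<bar> < e" for t
    proof (cases "t = 0")
      case False
      then show ?thesis
        using e(2)[OF False that] cI convex_image mem_is_interval_1_I[of "f ` I"]
        by (meson imageI is_interval_convex_1 less_imp_le)
    qed (use cI in auto)
    with e show ?thesis by blast
  qed
  have xy: "x \<in> I" "y \<in> I" using x y interior_subset by auto
  define du where "du = a * f' x"
  define dv where "dv = b * f' y"
  obtain e1 where e1: "e1 > 0" "\<And>t. \<bar>t\<bar> < e1 \<Longrightarrow> f x + t * du \<in> f ` I" using near[OF x] by blast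
  obtain e2 where e2: "e2 > 0" "\<And>t. \<bar>t\<bar> < e2 \<Longrightarrow> f y + t * dv \<in> f ` I" using near[OF y] by blast
  define e where "e = min e1 e2"
  define S where "S = {-e<..<e}"
  have e: "e > 0" using e1 e2 by (simp add: e_def)
  have S: "f x + t * du \<in> f ` I" "f y + t * dv \<in> f ` I" if "t \<in> S" for t
    using that e1(2)[of t] e2(2)[of t] by (auto simp: S_def e_def)
  define X where "X = (\<lambda>t. \<phi> (f x + t * du))"
  define Y where "Y = (\<lambda>t. \<phi> (f y + t * dv))"
  define A where "A = (\<lambda>t. du / f' (X t))"
  define B where "B = (\<lambda>t. dv / f' (Y t))"
  have at_S: "at t within S = at t" if "t \<in> S" for t
    using that by (intro at_within_open) (auto simp: S_def)
  note derivs = second_derivative_along_line[of S, OF S X_def Y_def A_def B_def]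
  have "f' ((X 0 + Y 0) / 2) / 4 * Q (X 0) (Y 0) (A 0) (B 0) \<ge> 0"
  proof (rule second_derivative_nonneg_of_midpoint_inequality[OF e])
    show "((\<lambda>t. G (f x + t * du) (f y + t * dv)) has_real_derivative
        f' ((X t + Y t) / 2) * ((A t + B t) / 2)) (at t)" if "\<bar>t\<bar> < e" for t
      using derivs(1)[of t] at_S[of t] that by (simp add: S_def abs_less_iff)
    show "((\<lambda>t. f' ((X t + Y t) / 2) * ((A t + B t) / 2)) has_real_derivative
        f' ((X 0 + Y 0) / 2) / 4 * Q (X 0) (Y 0) (A 0) (B 0)) (at 0)"
      using derivs(2)[of 0] at_S[of 0] e by (simp add: S_def)
    show "2 * G (f x + 0 * du) (f y + 0 * dv)
        \<le> G (f x + t * du) (f y + t * dv) + G (f x + - t * du) (f y + - t * dv)"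
      if "0 < t" "t < e" for t
      using G_midpoint_of_concave_mean[OF conc, of "f x" "t * du" "f y" "t * dv"] S[of t] S[of "- t"] that
      by (auto simp: S_def)
  qed
  moreover have "X 0 = x" "Y 0 = y" using xy by (auto simp: X_def Y_def \<phi>_f)
  moreover from this have "A 0 = a" "B 0 = b"
    using f'_pos[OF xy(1)] f'_pos[OF xy(2)] by (auto simp: A_def B_def du_def dv_def)
  ultimately show ?thesis
    using f'_pos[OF midpoint_in_I[OF xy]] by (simp add: zero_le_mult_iff)
qed

text \<open>
  Shrinking \<open>I\<close> towards an interior point \<open>c\<close> moves \<open>x\<close> and \<open>y\<close> into the interior, and \<open>Q\<close> is continuous
  in them.
\<close>

lemma Q_nonneg:
  assumes conc: "jensen_concave_mean I (quasi_arith_mean I f)"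
    and x: "x \<in> I" and y: "y \<in> I"
  shows "Q x y a b \<ge> 0"
proof -
  obtain l r where lr: "l \<in> I" "r \<in> I" "l < r" using nondegenerate by blast
  define c where "c = (l + r) / 2"
  have "{l..r} \<subseteq> I"
    using convex_I lr by (metis closed_segment_eq_real_ivl convex_contains_segment less_imp_le)
  then have "interior {l..r} \<subseteq> interior I" by (rule interior_mono)
  then have c: "c \<in> interior I" using lr by (auto simp: c_def)
  have shift: "w - s * (w - c) \<in> interior I" if "w \<in> I" "0 < s" "s \<le> 1" for w s
    using mem_interior_convex_shrink[OF convex_I c that] by simp
  have ev: "eventually (\<lambda>s. 0 < s \<and> s \<le> (1::real)) (at_right 0)"
    by (auto simp: eventually_at_right_field intro!: exI[of _ 1])
  have lim: "((\<lambda>s. p (Z s)) \<longlongrightarrow> p z) (at_right 0)"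
    if "(Z \<longlongrightarrow> z) (at_right 0)" "z \<in> I" "eventually (\<lambda>s. Z s \<in> I) (at_right 0)" for Z z
    using continuous_on_tendsto_compose[OF p_cont that] .
  let ?x = "\<lambda>s. x - s * (x - c)" and ?y = "\<lambda>s. y - s * (y - c)"
  have tx: "(?x \<longlongrightarrow> x) (at_right 0)" and ty: "(?y \<longlongrightarrow> y) (at_right 0)"
    by (auto intro!: tendsto_eq_intros)
  have ex: "eventually (\<lambda>s. ?x s \<in> interior I) (at_right 0)"
    and ey: "eventually (\<lambda>s. ?y s \<in> interior I) (at_right 0)"
    using ev by (auto elim!: eventually_mono intro: shift x y)
  have exy: "eventually (\<lambda>s. ?x s \<in> I \<and> ?y s \<in> I \<and> (?x s + ?y s) / 2 \<in> I) (at_right 0)"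
    using eventually_conj[OF ex ey]
    by (rule eventually_mono) (use interior_subset midpoint_in_I in blast)
  have "((\<lambda>s. Q (?x s) (?y s) a b) \<longlongrightarrow> Q x y a b) (at_right 0)"
    unfolding Q_def
    by (intro tendsto_intros lim tx ty x y midpoint_in_I eventually_mono[OF exy]) auto
  moreover have "eventually (\<lambda>s. 0 \<le> Q (?x s) (?y s) a b) (at_right 0)"
    using eventually_conj[OF ex ey] by (rule eventually_mono) (use Q_nonneg_interior[OF conc] in blast)
  ultimately show ?thesis by (rule tendsto_lowerbound) simp
qed

section \<open>Positivity of the form and convexity of the ratio\<close>

text \<open>
  With \<open>R = 1 / p\<close>, the Cauchy--Schwarz inequality gives
  \<open>(a + b)\<^sup>2 \<le> (R x + R y) * (a\<^sup>2 / R x + b\<^sup>2 / R y)\<close>, and midpoint concavity of \<open>R\<close> bounds \<open>R x + R y\<close> by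
  \<open>2 * R z\<close>.
\<close>

lemma Q_nonneg_of_ratio_convex:
  assumes nz: "\<And>x. x \<in> I \<Longrightarrow> f'' x \<noteq> 0"
    and conv: "convex_on I (\<lambda>x. f' x / f'' x)" and neg: "\<And>x. x \<in> I \<Longrightarrow> f' x / f'' x < 0"
    and x: "x \<in> I" and y: "y \<in> I"
  shows "Q x y a b \<ge> 0"
proof -
  define R where "R = (\<lambda>x. - (f' x / f'' x))"
  have pR: "p s = 1 / R s" and Rpos: "R s > 0" if "s \<in> I" for s
  proof -
    show "R s > 0" using neg[OF that] by (simp add: R_def)
    show "p s = 1 / R s" by (simp add: R_def p_def)
  qed
  define z where "z = (x + y) / 2"
  have z: "z \<in> I" using midpoint_in_I x y by (simp add: z_def)
  have "f' z / f'' z \<le> (f' x / f'' x + f' y / f'' y) / 2"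
    using convex_onD[OF conv, of "1/2" x y] x y by (simp add: z_def add_divide_distrib)
  then have Rz: "R x + R y \<le> 2 * R z" by (simp add: R_def)
  have pos: "R x > 0" "R y > 0" "R z > 0" using Rpos x y z by auto
  have "(a + b)\<^sup>2 \<le> (R x + R y) * (a\<^sup>2 / R x + b\<^sup>2 / R y)"
  proof -
    have "(R x + R y) * (a\<^sup>2 / R x + b\<^sup>2 / R y) - (a + b)\<^sup>2 = (R y * a - R x * b)\<^sup>2 / (R x * R y)"
      using pos by (simp add: field_simps power2_eq_square)
    moreover have "\<dots> \<ge> 0" using pos by simp
    ultimately show ?thesis by linarith
  qed
  also have "\<dots> \<le> 2 * R z * (a\<^sup>2 / R x + b\<^sup>2 / R y)"
    using Rz pos by (intro mult_right_mono) auto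
  finally have "(a + b)\<^sup>2 / R z \<le> 2 * (a\<^sup>2 / R x + b\<^sup>2 / R y)"
    using pos by (simp add: field_simps)
  then show ?thesis
    using x y z by (simp add: Q_def pR flip: z_def)
qed

text \<open>
  Special directions suffice: \<open>(1, -1)\<close> on the diagonal gives \<open>p \<ge> 0\<close>, \<open>(1, 0)\<close> makes a zero of \<open>p\<close> spread
  to midpoints, and \<open>(1 / p x, 1 / p y)\<close>, the minimiser for its sum, gives midpoint convexity of
  \<open>f' / f''\<close>.
\<close>

lemma ratio_convex_of_Q_nonneg:
  assumes Q: "\<And>x y a b. x \<in> I \<Longrightarrow> y \<in> I \<Longrightarrow> Q x y a b \<ge> 0"
    and "\<not> (\<forall>x\<in>I. f'' x = 0)"
  shows "(\<forall>x\<in>I. f'' x \<noteq> 0) \<and> convex_on I (\<lambda>x. f' x / f'' x) \<and> (\<forall>x\<in>I. f' x / f'' x < 0)"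
proof -
  have nonneg: "p x \<ge> 0" if "x \<in> I" for x
    using Q[OF that that, of 1 "-1"] by (simp add: Q_def)
  have step: "p ((x + y) / 2) = 0" if "x \<in> I" "y \<in> I" "p x = 0" for x y
    using Q[OF that(1,2), of 1 0] nonneg[OF midpoint_in_I[OF that(1,2)]] that(3) by (simp add: Q_def)
  have zero: "p y = 0" if x: "x \<in> I" "p x = 0" and y: "y \<in> I" for x y
  proof -
    \<comment> \<open>repeated bisection of the segment from \<open>x\<close> towards \<open>y\<close>\<close>
    define s where "s = (\<lambda>n. y + (x - y) * (1 / 2) ^ n)"
    have s: "s n \<in> I \<and> p (s n) = 0" for n
    proof (induction n)
      case (Suc n)
      have "s (Suc n) = (s n + y) / 2" by (simp add: s_def field_simps)
      then show ?case using Suc step y midpoint_in_I by metis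
    qed (use x in \<open>simp add: s_def\<close>)
    have "s \<longlonglongrightarrow> y + (x - y) * 0"
      unfolding s_def by (intro tendsto_intros LIMSEQ_power_zero) auto
    then have "(\<lambda>n. p (s n)) \<longlonglongrightarrow> p y"
      using s y by (intro continuous_on_tendsto_compose[OF p_cont]) auto
    then show ?thesis using s by (simp add: LIMSEQ_const_iff)
  qed
  obtain x0 where x0: "x0 \<in> I" "f'' x0 \<noteq> 0" using assms(2) by blast
  then have "p x0 \<noteq> 0" using f'_pos[OF x0(1)] by (simp add: p_def)
  then have pos: "p x > 0" if "x \<in> I" for x
    using zero[OF that _ x0(1)] nonneg[OF that] by fastforce
  have neg: "f'' x < 0" if "x \<in> I" for x
    using pos[OF that] f'_pos[OF that] by (simp add: p_def divide_less_0_iff)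
  have ratio: "f' x / f'' x = - (1 / p x)" for x by (simp add: p_def)
  have "convex_on I (\<lambda>x. f' x / f'' x)"
  proof (rule convex_on_of_midpoint_convex[OF convex_I])
    show "continuous_on I (\<lambda>x. f' x / f'' x)"
      using neg by (intro continuous_intros f'_cont f''_cont) fastforce
    fix x y assume xy: "x \<in> I" "y \<in> I"
    define z where "z = (x + y) / 2"
    have z: "p z > 0" using pos midpoint_in_I xy by (simp add: z_def)
    define s where "s = 1 / p x + 1 / p y"
    have "s > 0" using pos xy by (simp add: s_def add_pos_pos)
    have "p x * (1 / p x)\<^sup>2 = 1 / p x" "p y * (1 / p y)\<^sup>2 = 1 / p y"
      using pos[OF xy(1)] pos[OF xy(2)] by (auto simp: power2_eq_square)
    then have "p z * s\<^sup>2 \<le> 2 * s"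
      using Q[OF xy, of "1 / p x" "1 / p y"] by (simp add: Q_def mult.assoc s_def flip: z_def)
    then have "p z * s \<le> 2" using \<open>s > 0\<close> by (simp add: power2_eq_square)
    then have "s / 2 \<le> 1 / p z" using z by (simp add: field_simps)
    then show "f' ((x + y) / 2) / f'' ((x + y) / 2) \<le> (f' x / f'' x + f' y / f'' y) / 2"
      unfolding ratio by (simp add: s_def flip: z_def)
  qed
  moreover have "f' x / f'' x < 0" if "x \<in> I" for x
    using neg[OF that] f'_pos[OF that] by (simp add: divide_pos_neg)
  ultimately show ?thesis using neg by (metis less_irrefl)
qed

lemma concave_mean_iff:
  "jensen_concave_mean I (quasi_arith_mean I f) \<longleftrightarrow>
    (\<forall>x\<in>I. f'' x = 0) \<or>
    ((\<forall>x\<in>I. f'' x \<noteq> 0) \<and> convex_on I (\<lambda>x. f' x / f'' x) \<and> (\<forall>x\<in>I. f' x / f'' x < 0))"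
    (is "?L \<longleftrightarrow> ?Z \<or> ?R")
proof
  assume ?L
  then show "?Z \<or> ?R" using ratio_convex_of_Q_nonneg[OF Q_nonneg] by blast
next
  assume ZR: "?Z \<or> ?R"
  have "Q x y a b \<ge> 0" if "x \<in> I" "y \<in> I" for x y a b
  proof (cases ?Z)
    case True
    then show ?thesis using that midpoint_in_I by (simp add: Q_def p_def)
  next
    case False
    then show ?thesis using ZR that Q_nonneg_of_ratio_convex by blast
  qed
  then show ?L by (intro concave_mean_of_G_convex G_convex_of_Q_nonneg)
qed

end

section \<open>Generators of either sign of the derivative\<close>

lemma quasi_arith_mean_uminus: "quasi_arith_mean I (\<lambda>x. - f x) = quasi_arith_mean I f"
proof
  fix xs
  have "sum_list (map (\<lambda>x. - f x) xs) = - sum_list (map f xs)"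
    by (induction xs) auto
  then show "quasi_arith_mean I (\<lambda>x. - f x) xs = quasi_arith_mean I f xs"
    by (simp add: quasi_arith_mean_def inv_into_def)
qed

theorem theorem2p2:
  fixes I :: "real set" and f f' f'' :: "real \<Rightarrow> real"
  assumes "is_interval I"
    and "\<exists>a\<in>I. \<exists>b\<in>I. a < b"
    and "\<And>x. x \<in> I \<Longrightarrow> (f has_real_derivative f' x) (at x within I)"
    and "\<And>x. x \<in> I \<Longrightarrow> (f' has_real_derivative f'' x) (at x within I)"
    and "continuous_on I f''"
    and "\<And>x. x \<in> I \<Longrightarrow> f' x \<noteq> 0"
  shows "jensen_concave_mean I (quasi_arith_mean I f) \<longleftrightarrow>
    (\<forall>x\<in>I. f'' x = 0) \<or>
    ((\<forall>x\<in>I. f'' x \<noteq> 0) \<and>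
     convex_on I (\<lambda>x. f' x / f'' x) \<and> (\<forall>x\<in>I. f' x / f'' x < 0))"
proof -
  have "continuous_on I f'"
    using assms(4) by (meson DERIV_continuous continuous_on_eq_continuous_within)
  then have "is_interval (f' ` I)"
    using assms(1) connected_continuous_image by (simp add: is_interval_connected_1)
  then consider "\<forall>x\<in>I. f' x > 0" | "\<forall>x\<in>I. f' x < 0"
  proof -
    have "0 \<notin> f' ` I" using assms(6) by auto
    then have "\<not> (f' x < 0 \<and> f' y > 0)" if "x \<in> I" "y \<in> I" for x y
      using mem_is_interval_1_I[OF \<open>is_interval (f' ` I)\<close>, of "f' x" "f' y" 0] that by auto
    then show ?thesis using that assms(6) by (meson linorder_neqE_linordered_idom)
  qed
  then show ?thesis
  proof cases
    case 1
    then interpret increasing_generator I f f' f''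
      using assms by unfold_locales auto
    show ?thesis by (rule concave_mean_iff)
  next
    case 2
    then interpret increasing_generator I "\<lambda>x. - f x" "\<lambda>x. - f' x" "\<lambda>x. - f'' x"
      using assms by unfold_locales (auto intro!: derivative_eq_intros continuous_intros)
    show ?thesis
      using concave_mean_iff by (simp add: quasi_arith_mean_uminus)
  qed
qed

end
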